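(* Let $\bar S_n$ be the mean size of a semantic tree induced by a tree of size $n$, i.e. for $n\ge1$ the arithmetic mean over all plane rooted trees $T$ of size $n$ of the number of nodes of $\mathrm{Sem}(T)$, with $\bar S_0=0$. Then $(\bar S_n)_{n\ge0}$ satisfies, for all $n\ge0$, $$(2n^4+12n^3+22n^2+12n)\bar S_n-(4n^4+32n^3+87n^2+87n+18)\bar S_{n+1}+(2n^4+24n^3+85n^2+106n+39)\bar S_{n+2}-(4n^3+20n^2+31n+15)\bar S_{n+3}=0,$$ with the initial conditions $\bar S_0=0$, $\bar S_1=1$ and $\bar S_2=2$.
   Context: A syntax tree is a plane rooted tree, i.e. a rooted tree in which the children of each node are linearly ordered; its size is its number of nodes. The nodes of a given tree are regarded as carrying pairwise distinct names (actions), but trees are enumerated up to isomorphism of plane rooted trees (unlabelled). For a plane rooted tree $T$ whose root has children $v_1,\dots,v_r$ from left to right, and $1\le i\le r$, the $i$-contraction $T\lhd i$ is the plane tree with root $v_i$ whose root-subtrees are, from left to right, $T(v_1),\dots,T(v_{i-1}),T(v_{i_1}),\dots,T(v_{i_m}),T(v_{i+1}),\dots,T(v_r)$, where $T(v)$ is the subtree of all descendants of $v$ (including $v$) and $v_{i_1},\dots,v_{i_m}$ are the children of $v_i$ in order. The semantic tree $\mathrm{Sem}(T)$ is defined recursively: if $T$ is a single node, $\mathrm{Sem}(T)=T$; if $T$ has root $t$ with $r\ge1$ children, $\mathrm{Sem}(T)$ has root $t$ and root-subtrees $\mathrm{Sem}(T\lhd 1),\dots,\mathrm{Sem}(T\lhd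 r)$ from left to right. *)

theory Defs
  imports Complex_Main
begin

(* A node carries the name (action) of type 'a and the left-to-right list of its root-subtrees.
   Isomorphism classes of plane rooted trees, i.e. unlabelled trees, are the elements of
   unit ptree. *)

datatype 'a ptree = Node 'a "'a ptree list"

fun num_nodes :: "'a ptree \<Rightarrow> nat" where
  "num_nodes (Node a ts) = 1 + sum_list (map num_nodes ts)"

(* Children are numbered from 1, as in the usual notation for the i-contraction; the value is
   only meaningful for 1 \<le> i \<le> r, where r is the number of children of the root. *)

fun contraction :: "'a ptree \<Rightarrow> nat \<Rightarrow> 'a ptree" where
  "contraction (Node a ts) i =
     (case ts ! (i - 1) of Node b us \<Rightarrow> Node b (take (i - 1) ts @ us @ drop i ts))"

lemma num_nodes_contraction:
  assumes "1 \<le> i" "i \<le> length ts"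
  shows "num_nodes (contraction (Node a ts) i) + 1 = num_nodes (Node a ts)"
proof -
  obtain b us where u: "ts ! (i - Suc 0) = Node b us"
    by (cases "ts ! (i - Suc 0)") auto
  have "ts = take (i - 1) ts @ ts ! (i - 1) # drop i ts"
    using assms id_take_nth_drop[of "i - 1" ts] by simp
  then have "sum_list (map num_nodes ts) =
      sum_list (map num_nodes (take (i - 1) ts @ ts ! (i - 1) # drop i ts))"
    by metis
  then show ?thesis
    by (simp add: u)
qed

function Sem :: "'a ptree \<Rightarrow> 'a ptree" where
  "Sem (Node a ts) =
     Node a (map (\<lambda>i. Sem (contraction (Node a ts) i)) [1..<length ts + 1])"
  by pat_completeness auto
termination
proof (relation "measure num_nodes")
  show "wf (measure num_nodes)"
    by simp
next
  fix a :: 'a and ts :: "'a ptree list" and i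
  assume "i \<in> set [1..<length ts + 1]"
  then have "1 \<le> i" "i \<le> length ts"
    by auto
  then show "(contraction (Node a ts) i, Node a ts) \<in> measure num_nodes"
    using num_nodes_contraction[of i ts a] by (simp del: contraction.simps)
qed

(* Names play no role for sizes: the following lemmas justify averaging over unlabelled trees. *)

lemma num_nodes_map_ptree [simp]: "num_nodes (map_ptree f T) = num_nodes T"
proof (induction T)
  case (Node a ts)
  then have "map (num_nodes \<circ> map_ptree f) ts = map num_nodes ts"
    by simp
  then show ?case
    by (simp del: map_eq_conv)
qed

lemma contraction_map_ptree:
  assumes "1 \<le> i" "i \<le> length ts"
  shows "contraction (map_ptree f (Node a ts)) i = map_ptree f (contraction (Node a ts) i)"
  using assms by (cases "ts ! (i - Suc 0)") (simp add: take_map drop_map)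

lemma Sem_map_ptree: "Sem (map_ptree f T) = map_ptree f (Sem T)"
proof (induction T rule: Sem.induct)
  case (1 a ts)
  have "Sem (contraction (Node (f a) (map (map_ptree f) ts)) i) =
      map_ptree f (Sem (contraction (Node a ts) i))"
    if "i \<in> set [1..<length ts + 1]" for i
  proof -
    have "1 \<le> i" "i \<le> length ts"
      using that by auto
    then show ?thesis
      using 1[OF that] contraction_map_ptree[of i ts f a] by (simp del: contraction.simps)
  qed
  then show ?case
    by (simp del: contraction.simps)
qed

definition trees_of_size :: "nat \<Rightarrow> unit ptree set" where
  "trees_of_size n = {T. num_nodes T = n}"

lemma num_nodes_pos: "0 < num_nodes T"
  by (cases T) simp

lemma finite_trees_of_size: "finite (trees_of_size n)"
proof (induction n rule: less_induct)
  case (less n)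
  let ?A = "\<Union>m<n. trees_of_size m"
  have "trees_of_size n \<subseteq> Node () ` {ts. set ts \<subseteq> ?A \<and> length ts \<le> n}"
  proof
    fix T assume "T \<in> trees_of_size n"
    then obtain ts where T: "T = Node () ts" and n: "n = Suc (sum_list (map num_nodes ts))"
      by (cases T) (auto simp: trees_of_size_def)
    have "num_nodes t < n" if "t \<in> set ts" for t
      using member_le_sum_list[of "num_nodes t" "map num_nodes ts"] that n by simp
    moreover have "length ts \<le> sum_list (map num_nodes ts)"
    proof (induction ts)
      case (Cons t ts)
      then show ?case
        using num_nodes_pos[of t] by simp
    qed simp
    ultimately show "T \<in> Node () ` {ts. set ts \<subseteq> ?A \<and> length ts \<le> n}"
      using T n by (auto simp: trees_of_size_def)
  qed
  moreover have "finite {ts. set ts \<subseteq> ?A \<and> length ts \<le> n}"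
    using less by (intro finite_lists_length_le) auto
  ultimately show ?case
    using finite_surj by blast
qed

definition mean_sem_size :: "nat \<Rightarrow> real" where
  "mean_sem_size n =
     (if n = 0 then 0
      else (\<Sum>T\<in>trees_of_size n. real (num_nodes (Sem T))) / real (card (trees_of_size n)))"

end

theory Submission
  imports Defs
begin

text \<open>A node at depth k of Sem(T) is a sequence of k successive contractions of the forest of
  root-subtrees of T, and such sequences can be counted backwards: undoing a contraction means
  grouping consecutive trees of a forest under a new root, so the number of sequences of length k
  leading to a given forest depends only on its number l of trees and equals
  (2k-1)!! binomial(l+2k, 2k). Summing over all forests with m-k nodes gives (2k-1)!! times the
  coefficient of z^(m-k) in the (2k+1)-st power of the Catalan series, a ballot number. Dividing by
  the number of trees with n = m+1 nodes yields the mean as a sum over k < n of hypergeometric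
  terms, and the recurrence follows by creative telescoping.\<close>

section \<open>Contractions of plane forests\<close>

primrec subtrees :: "'a ptree \<Rightarrow> 'a ptree list" where
  "subtrees (Node a us) = us"

definition forests :: "nat \<Rightarrow> unit ptree list set" where
  "forests m = {ts. sum_list (map num_nodes ts) = m}"

text \<open>The i-contraction seen on root-subtrees only, with positions counted from 0. The root is
  dropped because its name does not affect sizes.\<close>

definition contract_at :: "'a ptree list \<Rightarrow> nat \<Rightarrow> 'a ptree list" where
  "contract_at ts i = take i ts @ subtrees (ts ! i) @ drop (Suc i) ts"

text \<open>Inverse operation to \<open>contract_at\<close>; \<open>j = 0\<close> is allowed and
  inserts a leaf.\<close>

definition group_at :: "unit ptree list \<Rightarrow> nat \<Rightarrow> nat \<Rightarrow> unit ptree list" where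
  "group_at us j i = take i us @ Node () (take j (drop i us)) # drop (i + j) us"

lemma trees_of_size_Suc: "trees_of_size (Suc m) = Node () ` forests m"
proof (rule set_eqI)
  fix T
  show "T \<in> trees_of_size (Suc m) \<longleftrightarrow> T \<in> Node () ` forests m"
    by (cases T) (auto simp: trees_of_size_def forests_def)
qed

lemma finite_forests: "finite (forests m)"
  using finite_trees_of_size[of "Suc m"]
  by (simp add: trees_of_size_Suc finite_image_iff inj_on_def)

lemma forests_0: "forests 0 = {[]}"
proof -
  have "ts = []" if "sum_list (map num_nodes ts) = 0" for ts :: "unit ptree list"
    using that num_nodes_pos[of "hd ts"] by (cases ts) simp_all
  then show ?thesis
    by (auto simp: forests_def)
qed

lemma length_contract_at:
  assumes "i < length ts"
  shows "Suc (length (contract_at ts i)) = length ts + length (subtrees (ts ! i))"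
  using assms by (simp add: contract_at_def)

lemma contract_at_in_forests:
  assumes "ts \<in> forests (Suc m)" "i < length ts"
  shows "contract_at ts i \<in> forests m"
proof -
  obtain us where u: "ts ! i = Node () us"
    by (cases "ts ! i") auto
  have "sum_list (map num_nodes ts) =
      sum_list (map num_nodes (take i ts @ ts ! i # drop (Suc i) ts))"
    using assms(2) by (metis id_take_nth_drop)
  then show ?thesis
    using assms(1) by (simp add: forests_def contract_at_def u)
qed

lemma take_take_drop: "take i us @ take j (drop i us) @ drop (i + j) us = us"
  using append_take_drop_id[of j "drop i us"] by (simp add: add.commute)

lemma group_at_in_forests:
  assumes "us \<in> forests m"
  shows "group_at us j i \<in> forests (Suc m)"
proof -
  have "sum_list (map num_nodes us) =
      sum_list (map num_nodes (take i us @ take j (drop i us) @ drop (i + j) us))"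
    by (simp only: take_take_drop)
  then show ?thesis
    using assms by (simp add: forests_def group_at_def)
qed

lemma contract_at_group_at:
  assumes "i + j \<le> length us"
  shows "contract_at (group_at us j i) i = us"
  using assms take_take_drop[of i us j] by (simp add: contract_at_def group_at_def nth_append)

lemma group_at_contract_at:
  fixes ts :: "unit ptree list"
  assumes "i < length ts"
  shows "group_at (contract_at ts i) (length (subtrees (ts ! i))) i = ts"
proof -
  obtain us where u: "ts ! i = Node () us"
    by (cases "ts ! i") auto
  show ?thesis
    using assms id_take_nth_drop[OF assms]
    by (simp add: contract_at_def group_at_def u min_def)
qed

text \<open>A contraction at position i is undone by choosing j consecutive trees, the first of them at
  position i, and grouping them under a new root.\<close>

lemma sum_contract_at:
  fixes h :: "unit ptree list \<Rightarrow> nat \<Rightarrow> nat \<Rightarrow> 'b::comm_monoid_add"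
  shows "(\<Sum>ts\<in>forests (Suc m). \<Sum>i<length ts. h (contract_at ts i) (length ts) i) =
    (\<Sum>us\<in>forests m. \<Sum>j\<le>length us. \<Sum>i\<le>length us - j. h us (Suc (length us - j)) i)"
proof -
  have "(\<Sum>ts\<in>forests (Suc m). \<Sum>i<length ts. h (contract_at ts i) (length ts) i) =
      (\<Sum>(ts, i)\<in>(SIGMA ts:forests (Suc m). {..<length ts}). h (contract_at ts i) (length ts) i)"
    by (rule sum.Sigma) (auto simp: finite_forests)
  also have "\<dots> = (\<Sum>(us, j, i)\<in>(SIGMA us:forests m. SIGMA j:{..length us}. {..length us - j}).
      h us (Suc (length us - j)) i)"
  \<comment> \<open>Contraction forgets only how many children the contracted node had. Recording
    this number as \<open>j\<close> makes it invertible, and the original forest then has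
    \<open>length us - j + 1\<close> trees.\<close>
  proof (rule sum.reindex_bij_witness[where
        i = "\<lambda>(us, j, i). (group_at us j i, i)" and
        j = "\<lambda>(ts, i). (contract_at ts i, length (subtrees (ts ! i)), i)"])
    fix a assume "a \<in> (SIGMA ts:forests (Suc m). {..<length ts})"
    then obtain ts i where a: "a = (ts, i)" and ts: "ts \<in> forests (Suc m)" "i < length ts"
      by auto
    note len = length_contract_at[OF ts(2)]
    show "(case case a of (ts, i) \<Rightarrow> (contract_at ts i, length (subtrees (ts ! i)), i) of
        (us, j, i) \<Rightarrow> (group_at us j i, i)) = a"
      using group_at_contract_at[OF ts(2)] by (simp add: a)
    show "(case a of (ts, i) \<Rightarrow> (contract_at ts i, length (subtrees (ts ! i)), i)) \<in>
        (SIGMA us:forests m. SIGMA j:{..length us}. {..length us - j})"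
      using contract_at_in_forests[OF ts] ts(2) len by (simp add: a)
    have "Suc (length (contract_at ts i) - length (subtrees (ts ! i))) = length ts"
      using ts(2) len by linarith
    then show "(case case a of (ts, i) \<Rightarrow> (contract_at ts i, length (subtrees (ts ! i)), i) of
        (us, j, i) \<Rightarrow> h us (Suc (length us - j)) i) =
        (case a of (ts, i) \<Rightarrow> h (contract_at ts i) (length ts) i)"
      by (simp add: a)
  next
    fix b assume "b \<in> (SIGMA us:forests m. SIGMA j:{..length us}. {..length us - j})"
    then obtain us j i where b: "b = (us, j, i)" and us: "us \<in> forests m" "i + j \<le> length us"
      by auto
    show "(case case b of (us, j, i) \<Rightarrow> (group_at us j i, i) of
        (ts, i) \<Rightarrow> (contract_at ts i, length (subtrees (ts ! i)), i)) = b"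
      using contract_at_group_at[OF us(2)] us(2) by (simp add: b group_at_def nth_append)
    show "(case b of (us, j, i) \<Rightarrow> (group_at us j i, i)) \<in>
        (SIGMA ts:forests (Suc m). {..<length ts})"
      using group_at_in_forests[OF us(1)] us(2) by (simp add: b) (simp add: group_at_def)
  qed
  also have "\<dots> = (\<Sum>us\<in>forests m. \<Sum>(j, i)\<in>(SIGMA j:{..length us}. {..length us - j}).
      h us (Suc (length us - j)) i)"
    by (rule sum.Sigma[symmetric]) (auto simp: finite_forests)
  also have "\<dots> = (\<Sum>us\<in>forests m. \<Sum>j\<le>length us. \<Sum>i\<le>length us - j. h us (Suc (length us - j)) i)"
    by (intro sum.cong refl sum.Sigma[symmetric]) auto
  finally show ?thesis .
qed

lemma sum_atMost_rev: "(\<Sum>j\<le>l. g (l - j)) = (\<Sum>e\<le>l. g e)" for l :: nat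
  using sum.nat_diff_reindex[of g "Suc l"] by (simp add: lessThan_Suc_atMost)

lemma forests_Suc_nonempty: "[] \<notin> forests (Suc m)"
  by (simp add: forests_def)

text \<open>Contracting only the first tree matches each nonempty forest with exactly one way of
  grouping an initial segment; \<open>e\<close> counts the trees left ungrouped.\<close>

lemma sum_contract_first:
  fixes g :: "nat \<Rightarrow> nat"
  shows "(\<Sum>ts\<in>forests (Suc m). g (length ts)) =
    (\<Sum>us\<in>forests m. \<Sum>e\<le>length us. g (Suc e))"
proof -
  have "(\<Sum>ts\<in>forests (Suc m). g (length ts)) =
      (\<Sum>ts\<in>forests (Suc m). \<Sum>i<length ts. if i = 0 then g (length ts) else 0)"
    using forests_Suc_nonempty by (intro sum.cong refl) (auto simp: sum.delta')
  also have "\<dots> = (\<Sum>us\<in>forests m. \<Sum>j\<le>length us. \<Sum>i\<le>length us - j.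
      if i = 0 then g (Suc (length us - j)) else 0)"
    by (rule sum_contract_at[where h = "\<lambda>us l i. if i = 0 then g l else 0"])
  also have "\<dots> = (\<Sum>us\<in>forests m. \<Sum>j\<le>length us. g (Suc (length us - j)))"
    by simp
  finally show ?thesis
    by (simp add: sum_atMost_rev[of "\<lambda>e. g (Suc e)"])
qed

section \<open>Ballot numbers\<close>

text \<open>This is the coefficient of \<open>z^s\<close> in \<open>C^(p+1)\<close>, where
  \<open>C\<close> is the Catalan series: trees have series \<open>z C\<close>, and
  \<open>C = 1/(1 - z C)\<close>.\<close>

definition weighted_forests :: "nat \<Rightarrow> nat \<Rightarrow> nat" where
  "weighted_forests s p = (\<Sum>ts\<in>forests s. (length ts + p) choose p)"

lemma weighted_forests_0: "weighted_forests 0 p = 1"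
  by (simp add: weighted_forests_def forests_0)

lemma weighted_forests_Suc_0: "weighted_forests (Suc s) 0 = weighted_forests s 1"
  using sum_contract_first[where g = "\<lambda>_. 1" and m = s]
  by (simp add: weighted_forests_def)

lemma sum_choose_diagonal: "(\<Sum>e\<le>l. (e + p) choose p) = (Suc l + p) choose Suc p"
  by (induction l) simp_all

text \<open>Coefficient form of \<open>C = 1 + z C^2\<close> multiplied by \<open>C^(p+1)\<close>.
  Pascal's rule splits the weight, and contracting the first tree turns the second part into a
  hockey-stick sum.\<close>

lemma weighted_forests_Suc_Suc:
  "weighted_forests (Suc s) (Suc p) = weighted_forests (Suc s) p + weighted_forests s (Suc (Suc p))"
proof -
  have "weighted_forests (Suc s) (Suc p) =
      weighted_forests (Suc s) p + (\<Sum>ts\<in>forests (Suc s). (length ts + p) choose Suc p)"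
    by (simp add: weighted_forests_def sum.distrib)
  also have "(\<Sum>ts\<in>forests (Suc s). (length ts + p) choose Suc p) =
      (\<Sum>us\<in>forests s. \<Sum>e\<le>length us. (e + Suc p) choose Suc p)"
    using sum_contract_first[where g = "\<lambda>l. (l + p) choose Suc p" and m = s] by simp
  also have "\<dots> = weighted_forests s (Suc (Suc p))"
    unfolding weighted_forests_def sum_choose_diagonal by simp
  finally show ?thesis .
qed

lemma weighted_forests_ballot:
  "real (weighted_forests s p) =
    real ((2 * s + p) choose s) - (if s = 0 then 0 else real ((2 * s + p) choose (s - 1)))"
proof (induction s arbitrary: p)
  case 0
  show ?case
    by (simp add: weighted_forests_0)
next
  case (Suc s)
  note IH = Suc
  show ?case
  proof (induction p)
    case 0
    \<comment> \<open>At the boundary \<open>p = 0\<close>, Pascal's rule alone leaves these two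
      central binomials to be identified.\<close>
    have "(2 * s + 1) choose Suc s = (2 * s + 1) choose s"
      using binomial_symmetric[of s "2 * s + 1"] by simp
    then show ?case
      using IH[of 1] by (cases s) (simp_all add: weighted_forests_Suc_0)
  next
    case (Suc p)
    then show ?case
      using IH[of "Suc (Suc p)"] by (cases s) (simp_all add: weighted_forests_Suc_Suc)
  qed
qed

text \<open>The difference of adjacent binomials becomes a product, so that quotients of ballot
  numbers are rational functions.\<close>

lemma weighted_forests_closed:
  "real (2 * s + p + 1) * real (weighted_forests s p) = real (p + 1) * real ((2 * s + p + 1) choose s)"
proof (cases s)
  case 0
  then show ?thesis
    by (simp add: weighted_forests_0)
next
  case (Suc t)
  define A B where "A = real ((2 * s + p) choose s)" and "B = real ((2 * s + p) choose t)"
  have "Suc t * ((2 * s + p) choose Suc t) = (2 * s + p - t) * ((2 * s + p) choose t)"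
    using binomial_absorb_comp[of "2 * s + p" t] binomial_absorption[of t "2 * s + p"] by simp
  then have "real (Suc t) * A = real (2 * s + p - t) * B"
    unfolding A_def B_def Suc of_nat_mult[symmetric] by simp
  then have AB: "real s * A = (real s + real p + 1) * B"
    by (simp add: Suc of_nat_diff algebra_simps)
  have V: "real (weighted_forests s p) = A - B"
    by (simp add: weighted_forests_ballot Suc A_def B_def)
  have C: "real ((2 * s + p + 1) choose s) = A + B"
    by (simp add: Suc A_def B_def)
  show ?thesis
    unfolding V C using AB by (simp add: algebra_simps)
qed

text \<open>Both sides have the same upper index \<open>2 * s + p + 3\<close> in the closed form, so
  only the ratio of two adjacent binomials remains. With \<open>p = 2 * k\<close> this is the
  passage from depth \<open>k\<close> to depth \<open>k + 1\<close>.\<close>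

lemma weighted_forests_ratio:
  "real (p + 1) * real (s + p + 3) * real (weighted_forests s (p + 2)) =
    real (p + 3) * real (s + 1) * real (weighted_forests (Suc s) p)"
proof -
  define N where "N = 2 * s + p + 3"
  have N: "2 * s + (p + 2) + 1 = N" "p + 2 + 1 = p + 3" "2 * Suc s + p + 1 = N"
    by (simp_all add: N_def)
  have 1: "real N * real (weighted_forests s (p + 2)) = real (p + 3) * real (N choose s)"
    using weighted_forests_closed[of s "p + 2"] unfolding N .
  have 2: "real N * real (weighted_forests (Suc s) p) = real (p + 1) * real (N choose Suc s)"
    using weighted_forests_closed[of "Suc s" p] unfolding N .
  have "Suc s * (N choose Suc s) = (N - s) * (N choose s)"
    using binomial_absorb_comp[of N s] binomial_absorption[of s N] by simp
  then have 3: "real (s + 1) * real (N choose Suc s) = real (s + p + 3) * real (N choose s)"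
    unfolding of_nat_mult[symmetric] by (simp add: N_def)
  have "real N * (real (p + 1) * real (s + p + 3) * real (weighted_forests s (p + 2))) =
      real (p + 1) * real (s + p + 3) * (real N * real (weighted_forests s (p + 2)))"
    by (simp only: mult_ac)
  also have "\<dots> = real (p + 1) * real (p + 3) * (real (s + p + 3) * real (N choose s))"
    unfolding 1 by (simp only: mult_ac)
  also have "\<dots> = real (p + 3) * real (s + 1) * (real (p + 1) * real (N choose Suc s))"
    unfolding 3[symmetric] by (simp only: mult_ac)
  also have "\<dots> = real N * (real (p + 3) * real (s + 1) * real (weighted_forests (Suc s) p))"
    unfolding 2[symmetric] by (simp only: mult_ac)
  finally show ?thesis
    by (simp add: N_def)
qed

section \<open>The mean size of the semantic tree\<close>

definition sem_size :: "unit ptree list \<Rightarrow> nat" where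
  "sem_size ts = num_nodes (Sem (Node () ts))"

definition odd_fact :: "nat \<Rightarrow> nat" where
  "odd_fact k = (\<Prod>j<k. 2 * j + 1)"

definition history_weight :: "nat \<Rightarrow> nat \<Rightarrow> nat" where
  "history_weight k l = odd_fact k * ((l + 2 * k) choose (2 * k))"

lemma sem_size_unit:
  "sem_size ts = 1 + (\<Sum>i<length ts. sem_size (contract_at ts i))"
proof -
  have c: "contraction (Node () ts) (Suc i) = Node () (contract_at ts i)" for i
    by (cases "ts ! i") (simp add: contract_at_def)
  have "sem_size ts =
      1 + (\<Sum>i\<leftarrow>[1..<length ts + 1]. num_nodes (Sem (contraction (Node () ts) i)))"
    by (simp add: sem_size_def comp_def del: contraction.simps upt_Suc)
  also have "\<dots> = 1 + (\<Sum>i\<leftarrow>[0..<length ts]. num_nodes (Sem (contraction (Node () ts) (Suc i))))"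
    by (simp add: map_Suc_upt[symmetric] comp_def del: contraction.simps Sem.simps upt_Suc map_Suc_upt)
  also have "\<dots> = 1 + (\<Sum>i<length ts. sem_size (contract_at ts i))"
    by (simp add: c sem_size_def interv_sum_list_conv_sum_set_nat atLeast0LessThan
        del: contraction.simps Sem.simps)
  finally show ?thesis .
qed

text \<open>Undoing one contraction from \<open>l\<close> trees leaves \<open>Suc e\<close> trees,
  where \<open>l - e\<close> are grouped, and the new root can stand at any of \<open>Suc e\<close>
  positions.\<close>

lemma history_weight_Suc:
  "(\<Sum>e\<le>l. Suc e * history_weight k (Suc e)) = history_weight (Suc k) l"
proof (induction l)
  case 0
  show ?case
    by (simp add: history_weight_def odd_fact_def)
next
  case (Suc l)
  define N where "N = l + 2 + 2 * k"
  \<comment> \<open>The increment of the right-hand side from \<open>l\<close> to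
    \<open>Suc l\<close>; the odd factor is the one that \<open>odd_fact\<close> gains.\<close>
  have "(2 * k + 1) * (N choose (2 * k + 1)) = (N - 2 * k) * (N choose (2 * k))"
    using binomial_absorb_comp[of N "2 * k"] binomial_absorption[of "2 * k" N] by simp
  then have "odd_fact k * ((l + 2) * (N choose (2 * k))) =
      odd_fact k * ((2 * k + 1) * (N choose (2 * k + 1)))"
    by (simp add: N_def)
  moreover have "history_weight (Suc k) (Suc l) =
      history_weight (Suc k) l + odd_fact k * ((2 * k + 1) * (N choose (2 * k + 1)))"
    by (simp add: history_weight_def odd_fact_def N_def algebra_simps)
  moreover have "history_weight k (Suc (Suc l)) = odd_fact k * (N choose (2 * k))"
    by (simp add: history_weight_def N_def)
  ultimately show ?case
    using Suc by (simp add: algebra_simps)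
qed

lemma sum_history_weight:
  "(\<Sum>ts\<in>forests s. history_weight k (length ts)) = odd_fact k * weighted_forests s (2 * k)"
  by (simp add: history_weight_def weighted_forests_def sum_distrib_left)

text \<open>The weight of a forest counts the sequences of k contractions leading to it, so increasing k
  transfers the recursion of the semantic tree from a forest to its contractions.\<close>

lemma sum_sem_size:
  "(\<Sum>ts\<in>forests m. history_weight k (length ts) * sem_size ts) =
    (\<Sum>i\<le>m. odd_fact (k + i) * weighted_forests (m - i) (2 * (k + i)))"
proof (induction m arbitrary: k)
  case 0
  show ?case
    using sum_history_weight[of k 0] by (simp add: forests_0 sem_size_unit[of "[]"])
next
  case (Suc m)
  have "(\<Sum>ts\<in>forests (Suc m). history_weight k (length ts) * sem_size ts) =
      odd_fact k * weighted_forests (Suc m) (2 * k) +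
      (\<Sum>ts\<in>forests (Suc m). \<Sum>i<length ts.
        history_weight k (length ts) * sem_size (contract_at ts i))"
    unfolding sum_history_weight[symmetric] sum.distrib[symmetric]
    by (intro sum.cong refl, subst sem_size_unit) (simp add: sum_distrib_left)
  also have "(\<Sum>ts\<in>forests (Suc m). \<Sum>i<length ts.
        history_weight k (length ts) * sem_size (contract_at ts i)) =
      (\<Sum>us\<in>forests m. \<Sum>j\<le>length us. \<Sum>i\<le>length us - j.
        history_weight k (Suc (length us - j)) * sem_size us)"
    by (rule sum_contract_at[where h = "\<lambda>us l i. history_weight k l * sem_size us"])
  \<comment> \<open>The summand no longer depends on the position \<open>i\<close>, so the inner sum
    only contributes the number of positions, as \<open>history_weight_Suc\<close> requires.\<close>
  also have "\<dots> = (\<Sum>us\<in>forests m.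
      (\<Sum>j\<le>length us. Suc (length us - j) * history_weight k (Suc (length us - j))) * sem_size us)"
    by (simp add: sum_distrib_right mult.assoc del: mult_Suc)
  also have "\<dots> = (\<Sum>us\<in>forests m. history_weight (Suc k) (length us) * sem_size us)"
    by (simp only: sum_atMost_rev[of "\<lambda>e. Suc e * history_weight k (Suc e)"] history_weight_Suc)
  also have "\<dots> = (\<Sum>i\<le>m. odd_fact (Suc k + i) * weighted_forests (m - i) (2 * (Suc k + i)))"
    by (rule Suc)
  finally show ?case
    unfolding sum.atMost_Suc_shift by simp
qed

text \<open>The k-th term is the mean number of nodes at depth k of the semantic tree of a tree with
  n nodes.\<close>

definition mean_profile :: "nat \<Rightarrow> nat \<Rightarrow> real" where
  "mean_profile n k =
    (\<Prod>j<k. (2 * real j + 3) * (real n - real j - 1) / (real n + real j + 1))"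

lemma mean_profile_0 [simp]: "mean_profile n 0 = 1"
  by (simp add: mean_profile_def)

lemma mean_profile_Suc:
  "mean_profile n (Suc k) =
    mean_profile n k * ((2 * real k + 3) * (real n - real k - 1) / (real n + real k + 1))"
  by (simp add: mean_profile_def)

text \<open>The factor with \<open>j = n - 1\<close> vanishes, which lets sums over \<open>k\<close>
  run past \<open>n\<close>. For \<open>n = 0\<close> no factor vanishes.\<close>

lemma mean_profile_eq_0:
  assumes "n \<le> k" "0 < n"
  shows "mean_profile n k = 0"
  unfolding mean_profile_def
proof (rule prod_zero)
  have "n - 1 \<in> {..<k}" "real n - real (n - 1) - 1 = 0"
    using assms by (auto simp: of_nat_diff)
  then show "\<exists>j\<in>{..<k}. (2 * real j + 3) * (real n - real j - 1) / (real n + real j + 1) = 0"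
    by (intro bexI[of _ "n - 1"]) simp_all
qed simp

lemma weighted_forests_pos: "0 < weighted_forests s p"
proof -
  have "0 < real (p + 1) * real ((2 * s + p + 1) choose s)"
    by (simp add: zero_less_binomial_iff del: of_nat_Suc of_nat_add)
  then have "0 < real (2 * s + p + 1) * real (weighted_forests s p)"
    by (simp only: weighted_forests_closed)
  then show ?thesis
    by (simp add: zero_less_mult_iff)
qed

text \<open>Iterates \<open>weighted_forests_ratio\<close>: each step lowers \<open>m - k\<close> by
  1 and raises \<open>2 * k\<close> by 2, and the new factor of \<open>odd_fact\<close> cancels
  against the ratio.\<close>

lemma weighted_forests_mean_profile:
  "k \<le> m \<Longrightarrow> real (odd_fact k * weighted_forests (m - k) (2 * k)) =
    mean_profile (Suc m) k * real (weighted_forests m 0)"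
proof (induction k)
  case 0
  show ?case
    by (simp add: odd_fact_def)
next
  case (Suc k)
  define s where "s = m - Suc k"
  have m: "m = s + Suc k"
    using Suc.prems by (simp add: s_def)
  define X Y where "X = real (weighted_forests s (2 * k + 2))"
    and "Y = real (weighted_forests (Suc s) (2 * k))"
  have r: "(2 * real k + 1) * (real s + 2 * real k + 3) * X = (2 * real k + 3) * (real s + 1) * Y"
    using weighted_forests_ratio[of "2 * k" s] by (simp add: X_def Y_def add_ac)
  have IH: "real (odd_fact k) * Y = mean_profile (Suc m) k * real (weighted_forests m 0)"
    using Suc by (simp add: Y_def m Suc_diff_le)
  have pos: "real s + 2 * real k + 3 > 0"
    by linarith
  have "real (odd_fact (Suc k) * weighted_forests (m - Suc k) (2 * Suc k)) =
      real (odd_fact k) * ((2 * real k + 1) * X)"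
    by (simp add: odd_fact_def m X_def algebra_simps)
  also have "(2 * real k + 1) * X = Y * ((2 * real k + 3) * (real s + 1) / (real s + 2 * real k + 3))"
    using r pos by (simp add: field_simps)
  also have "real (odd_fact k) * \<dots> = mean_profile (Suc m) k * real (weighted_forests m 0) *
      ((2 * real k + 3) * (real s + 1) / (real s + 2 * real k + 3))"
    by (simp only: IH[symmetric] mult.assoc)
  also have "\<dots> = mean_profile (Suc m) (Suc k) * real (weighted_forests m 0)"
    by (simp add: mean_profile_Suc m algebra_simps)
  finally show ?case .
qed

lemma mean_sem_size_eq: "mean_sem_size n = (\<Sum>k<n. mean_profile n k)"
proof (cases n)
  case 0
  then show ?thesis
    by (simp add: mean_sem_size_def)
next
  case (Suc m)
  have inj: "inj_on (Node ()) (forests m)"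
    by (simp add: inj_on_def)
  have "card (trees_of_size n) = weighted_forests m 0"
    by (simp add: Suc trees_of_size_Suc card_image[OF inj] weighted_forests_def)
  \<comment> \<open>Histories of length 0 have weight 1, so the total size is the case
    \<open>k = 0\<close> of \<open>sum_sem_size\<close>.\<close>
  moreover have "(\<Sum>T\<in>trees_of_size n. real (num_nodes (Sem T))) =
      real (\<Sum>ts\<in>forests m. history_weight 0 (length ts) * sem_size ts)"
    by (simp add: Suc trees_of_size_Suc sum.reindex[OF inj] history_weight_def odd_fact_def
        sem_size_def del: Sem.simps)
  moreover have "\<dots> = (\<Sum>k\<le>m. mean_profile n k * real (weighted_forests m 0))"
    unfolding sum_sem_size by (simp add: weighted_forests_mean_profile Suc del: of_nat_mult)
  moreover have "\<dots> = (\<Sum>k<n. mean_profile n k) * real (weighted_forests m 0)"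
    by (simp add: sum_distrib_right Suc lessThan_Suc_atMost)
  ultimately show ?thesis
    using weighted_forests_pos[of m 0] by (simp add: mean_sem_size_def Suc)
qed

section \<open>Creative telescoping\<close>

text \<open>In the quotient of the two products the factors telescope. The form without denominators
  also covers \<open>k = n\<close> and \<open>n = 0\<close>.\<close>

lemma mean_profile_shift:
  "real n * (real n + 1) * mean_profile n k =
    (real n - real k) * (real n + real k + 1) * mean_profile (Suc n) k"
proof (induction k)
  case 0
  show ?case
    by simp
next
  case (Suc k)
  define M where "M = mean_profile (Suc n) k"
  have n0: "real n + real k + 1 > 0" "real n + real k + 2 > 0"
    by linarith+
  have "real n * (real n + 1) * mean_profile n (Suc k) = (real n * (real n + 1) * mean_profile n k) *
      ((2 * real k + 3) * (real n - real k - 1) / (real n + real k + 1))"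
    by (simp add: mean_profile_Suc)
  also have "\<dots> = (real n - real k) * M * (2 * real k + 3) * (real n - real k - 1)"
    unfolding Suc M_def[symmetric] using n0 by simp
  also have "\<dots> = (real n - real (Suc k)) * (real n + real (Suc k) + 1) *
      (M * ((2 * real k + 3) * (real n - real k) / (real n + real k + 2)))"
    using n0 by (simp add: field_simps)
  also have "M * ((2 * real k + 3) * (real n - real k) / (real n + real k + 2)) =
      mean_profile (Suc n) (Suc k)"
    by (simp add: mean_profile_Suc M_def add_ac)
  finally show ?case .
qed

text \<open>Zeilberger's certificate, found by solving a linear system for the coefficients of its
  polynomial factor.\<close>

definition certificate :: "nat \<Rightarrow> nat \<Rightarrow> real" where
  "certificate n k =
    (real n + real k + 3) * real k *
    (real k ^ 3 + (real n - 1) * real k ^ 2 - (2 * real n + 3) * real k + 3 * real n + 5) /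
    ((real n + 1) * (real n + 2)) * mean_profile (n + 3) k"

text \<open>The shift in \<open>n\<close> and the step in \<open>k\<close> make every term a
  rational multiple of \<open>M = mean_profile (n + 3) k\<close>; clearing denominators leaves a
  polynomial identity.\<close>

lemma mean_profile_telescopes:
  "(2 * real n ^ 4 + 12 * real n ^ 3 + 22 * real n ^ 2 + 12 * real n) * mean_profile n k
    - (4 * real n ^ 4 + 32 * real n ^ 3 + 87 * real n ^ 2 + 87 * real n + 18) * mean_profile (n + 1) k
    + (2 * real n ^ 4 + 24 * real n ^ 3 + 85 * real n ^ 2 + 106 * real n + 39) * mean_profile (n + 2) k
    - (4 * real n ^ 3 + 20 * real n ^ 2 + 31 * real n + 15) * mean_profile (n + 3) k
    = certificate n (Suc k) - certificate n k"
proof -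
  define x y where "x = real n" and "y = real k"
  define M where "M = mean_profile (n + 3) k"
  have pos: "x + 1 > 0" "x + 2 > 0" "x + 3 > 0" "x + y + 4 > 0"
    by (simp_all add: x_def y_def add_nonneg_pos)
  have e: "Suc (n + 2) = n + 3" "Suc (n + 1) = n + 2"
    "real (n + 2) = x + 2" "real (n + 1) = x + 1" "real k = y" "mean_profile (n + 3) k = M"
    by (simp_all add: x_def y_def M_def)
  define M1 M2 where "M1 = mean_profile (n + 1) k" and "M2 = mean_profile (n + 2) k"
  have m2: "(x + 2) * (x + 3) * M2 = (x + 2 - y) * (x + y + 3) * M"
    using mean_profile_shift[of "n + 2" k] unfolding e M2_def by algebra
  have m1: "(x + 1) * (x + 2) * M1 = (x + 1 - y) * (x + y + 2) * M2"
    using mean_profile_shift[of "n + 1" k] unfolding e M1_def M2_def by algebra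
  have "x * (x + 1) * mean_profile n k = (x - y) * (x + y + 1) * M1"
    using mean_profile_shift[of n k] by (simp add: x_def y_def M1_def)
  \<comment> \<open>This factorization supplies the \<open>x * (x + 1)\<close> of the shift, so
    nothing is divided by \<open>x\<close>, which may be 0.\<close>
  moreover have "2 * x ^ 4 + 12 * x ^ 3 + 22 * x ^ 2 + 12 * x = 2 * (x + 2) * (x + 3) * (x * (x + 1))"
    by algebra
  ultimately have m0: "(2 * x ^ 4 + 12 * x ^ 3 + 22 * x ^ 2 + 12 * x) * mean_profile n k =
      2 * (x + 2) * (x + 3) * ((x - y) * (x + y + 1) * M1)"
    by (simp add: mult.assoc)
  define r where "r = (\<lambda>z. z * (z ^ 3 + (x - 1) * z ^ 2 - (2 * x + 3) * z + 3 * x + 5))"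
  have c0: "certificate n k = (x + y + 3) * r y * M / ((x + 1) * (x + 2))"
    by (simp add: certificate_def x_def y_def M_def r_def)
  \<comment> \<open>The denominator \<open>x + y + 4\<close> cancels against the linear factor of
    the certificate at \<open>Suc k\<close>.\<close>
  have "mean_profile (n + 3) (Suc k) = M * ((2 * y + 3) * (x + 2 - y) / (x + y + 4))"
    by (simp add: mean_profile_Suc x_def y_def M_def algebra_simps)
  moreover have "certificate n (Suc k) =
      (x + y + 4) * r (y + 1) * mean_profile (n + 3) (Suc k) / ((x + 1) * (x + 2))"
    by (simp add: certificate_def x_def y_def r_def algebra_simps)
  ultimately have c1: "certificate n (Suc k) =
      r (y + 1) * (2 * y + 3) * (x + 2 - y) * M / ((x + 1) * (x + 2))"
    using pos by simp
  \<comment> \<open>\<open>D\<close> is the product of the factors multiplying \<open>M1\<close> and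
    \<open>M2\<close> in \<open>m1\<close> and \<open>m2\<close>, a common denominator for all
    terms.\<close>
  define p1 p2 p3 D where "p1 = 4 * x ^ 4 + 32 * x ^ 3 + 87 * x ^ 2 + 87 * x + 18"
    and "p2 = 2 * x ^ 4 + 24 * x ^ 3 + 85 * x ^ 2 + 106 * x + 39"
    and "p3 = 4 * x ^ 3 + 20 * x ^ 2 + 31 * x + 15"
    and "D = (x + 1) * (x + 2) ^ 2 * (x + 3)"
  note defs = p1_def p2_def p3_def D_def r_def
  have D1: "D * M1 = (x + 1 - y) * (x + y + 2) * (x + 2 - y) * (x + y + 3) * M"
    using m1 m2 unfolding D_def by algebra
  have D2: "D * M2 = (x + 1) * (x + 2) * (x + 2 - y) * (x + y + 3) * M"
    using m2 unfolding D_def by algebra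
  have "D * (certificate n (Suc k) - certificate n k) =
      (x + 2) * (x + 3) * ((x + 1) * (x + 2) * certificate n (Suc k) - (x + 1) * (x + 2) * certificate n k)"
    unfolding D_def by algebra
  also have "(x + 1) * (x + 2) * certificate n (Suc k) = r (y + 1) * (2 * y + 3) * (x + 2 - y) * M"
    unfolding c1 using pos by simp
  also have "(x + 1) * (x + 2) * certificate n k = (x + y + 3) * r y * M"
    unfolding c0 using pos by simp
  finally have DG: "D * (certificate n (Suc k) - certificate n k) =
      (x + 2) * (x + 3) * (r (y + 1) * (2 * y + 3) * (x + 2 - y) * M - (x + y + 3) * r y * M)" .
  have "D * (2 * (x + 2) * (x + 3) * ((x - y) * (x + y + 1) * M1) - p1 * M1 + p2 * M2 - p3 * M) =
      (2 * (x + 2) * (x + 3) * (x - y) * (x + y + 1) - p1) * (D * M1) + p2 * (D * M2) - p3 * D * M"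
    by algebra
  also have "\<dots> = D * (certificate n (Suc k) - certificate n k)"
    unfolding DG D1 D2 unfolding defs by algebra
  finally have "2 * (x + 2) * (x + 3) * ((x - y) * (x + y + 1) * M1) - p1 * M1 + p2 * M2 - p3 * M =
      certificate n (Suc k) - certificate n k"
    using pos by (simp add: D_def)
  then show ?thesis
    using m0 by (simp add: p1_def p2_def p3_def x_def M_def M1_def M2_def)
qed

theorem theorem29:
  shows "(\<forall>n::nat.
      (2 * real n ^ 4 + 12 * real n ^ 3 + 22 * real n ^ 2 + 12 * real n) * mean_sem_size n
      - (4 * real n ^ 4 + 32 * real n ^ 3 + 87 * real n ^ 2 + 87 * real n + 18)
          * mean_sem_size (n + 1)
      + (2 * real n ^ 4 + 24 * real n ^ 3 + 85 * real n ^ 2 + 106 * real n + 39)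
          * mean_sem_size (n + 2)
      - (4 * real n ^ 3 + 20 * real n ^ 2 + 31 * real n + 15) * mean_sem_size (n + 3) = 0)
    \<and> mean_sem_size 0 = 0 \<and> mean_sem_size 1 = 1 \<and> mean_sem_size 2 = 2"
proof (intro conjI allI)
  fix n :: nat
  \<comment> \<open>A common upper limit past which all four sums have only zero terms, except when
    \<open>n = 0\<close>.\<close>
  define N where "N = n + 3"
  have extend: "mean_sem_size i = (\<Sum>k<N. mean_profile i k)" if "0 < i" "i \<le> N" for i
    unfolding mean_sem_size_eq using that
    by (intro sum.mono_neutral_left) (auto simp: mean_profile_eq_0)
  define p where "p = 2 * real n ^ 4 + 12 * real n ^ 3 + 22 * real n ^ 2 + 12 * real n"
  \<comment> \<open>For \<open>n = 0\<close> the sum cannot be extended, but then the coefficient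
    \<open>p\<close> is 0.\<close>
  have S0: "p * mean_sem_size n = p * (\<Sum>k<N. mean_profile n k)"
    using extend[of n] by (cases "n = 0") (auto simp: p_def N_def)
  have S: "mean_sem_size (n + 1) = (\<Sum>k<N. mean_profile (n + 1) k)"
    "mean_sem_size (n + 2) = (\<Sum>k<N. mean_profile (n + 2) k)"
    "mean_sem_size (n + 3) = (\<Sum>k<N. mean_profile (n + 3) k)"
    by (rule extend; simp add: N_def)+
  have "(\<Sum>k<N. certificate n (Suc k) - certificate n k) = certificate n N - certificate n 0"
    by (rule sum_lessThan_telescope)
  \<comment> \<open>The lower end vanishes by the factor \<open>k\<close> of the certificate, the
    upper end because \<open>mean_profile (n + 3) (n + 3) = 0\<close>.\<close>
  also have "\<dots> = 0"
    by (simp add: certificate_def mean_profile_eq_0 N_def)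
  finally show "(2 * real n ^ 4 + 12 * real n ^ 3 + 22 * real n ^ 2 + 12 * real n) * mean_sem_size n
      - (4 * real n ^ 4 + 32 * real n ^ 3 + 87 * real n ^ 2 + 87 * real n + 18)
          * mean_sem_size (n + 1)
      + (2 * real n ^ 4 + 24 * real n ^ 3 + 85 * real n ^ 2 + 106 * real n + 39)
          * mean_sem_size (n + 2)
      - (4 * real n ^ 3 + 20 * real n ^ 2 + 31 * real n + 15) * mean_sem_size (n + 3) = 0"
    unfolding p_def[symmetric] S0 S mean_profile_telescopes[symmetric]
    by (simp add: p_def sum.distrib sum_subtractf sum_distrib_left)
next
  show "mean_sem_size 0 = 0" "mean_sem_size 1 = 1" "mean_sem_size 2 = 2"
    by (simp_all add: mean_sem_size_eq mean_profile_def numeral_2_eq_2)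
qed

end
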